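(* Let $q\ge4$ be an integer. The map $\hat\pi\colon I_q\setminus\partial\mathcal{J}(f_q)\to\mathcal{A}_q^{\mathrm{reg}}$ is bijective. The inverse map $\hat\pi^{-1}\colon\mathcal{A}_q^{\mathrm{reg}}\to I_q\setminus\partial\mathcal{J}(f_q)$ is given by $\hat\pi^{-1}(\underline{a})=[0;a_1,a_2,\dots]$ for $\underline{a}=(a_i)_{i\in\mathbb{N}}$.
   Context: Let $\lambda_q=2\cos(\pi/q)$ and $I_q=[-\lambda_q/2,\lambda_q/2]$. Let $\lfloor x\rfloor'$ be the integer $n$ with $n<x\le n+1$ if $x>0$ and $n\le x<n+1$ if $x\le0$, and put $\langle x\rangle_q=\lfloor x/\lambda_q+1/2\rfloor'$. The map $f_q\colon I_q\to I_q$ is $f_q(x)=-\frac1x-\langle-\frac1x\rangle_q\,\lambda_q$ for $x\ne0$ and $f_q(0)=0$. Define $J_1=\big[-\frac{\lambda_q}{2},-\frac{2}{3\lambda_q}\big]$, $J_m=\big[-\frac{2}{(2m-1)\lambda_q},-\frac{2}{(2m+1)\lambda_q}\big]$ for $m\ge2$, and $J_{-m}=-J_m$ for $m\ge1$. The set $\partial\mathcal{J}(f_q)$ consists of the boundary points of all the intervals $J_m$, $m\in\mathbb{Z}\setminus\{0\}$, the point $0$, and all preimages of these points under iterates of $f_q$. The map $\hat\pi$ is defined by $\hat\pi(x)=(a_i)_{i\in\mathbb{N}}\in(\mathbb{Z}\setminus\{0\})^{\mathbb{N}}$ when $f_q^{i-1}(x)\in J_{a_i}$ for all $i\in\mathbb{N}=\{1,2,\dots\}$.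 Put $h_q=\frac{q-2}{2}$ for $q$ even and $h_q=\frac{q-3}{2}$ for $q$ odd; $(a)^k$ denotes $a$ repeated $k$ times. The forbidden blocks $\mathcal{B}_q$ (same sign throughout each block) are: for $q$ even, $((\pm1)^{h_q+1})$ and $((\pm1)^{h_q},\pm m)$, $m\ge1$; for $q\ge5$ odd, $((\pm1)^{h_q+1})$ and $((\pm1)^{h_q},\pm2,(\pm1)^{h_q},\pm m)$, $m\ge1$. $\mathcal{A}_q^{\mathrm{reg}}$ is the set of infinite sequences $(a_i)_{i\in\mathbb{N}}$ of nonzero integers with $(a_l,a_{l+1},\dots,a_L)\notin\mathcal{B}_q$ for all $1\le l<L$. The symbol $[0;a_1,a_2,\dots]$ denotes the limit as $n\to\infty$ of $\cfrac{-1}{a_1\lambda_q+\cfrac{-1}{a_2\lambda_q+\cdots+\cfrac{-1}{a_n\lambda_q}}}$. *)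

theory Defs
  imports "HOL-Analysis.Analysis"
begin

definition hecke_lambda :: "nat \<Rightarrow> real" where
  "hecke_lambda q = 2 * cos (pi / real q)"

definition I_q :: "nat \<Rightarrow> real set" where
  "I_q q = {- hecke_lambda q / 2 .. hecke_lambda q / 2}"

definition floor' :: "real \<Rightarrow> int" where
  "floor' x = (if x > 0 then \<lceil>x\<rceil> - 1 else \<lfloor>x\<rfloor>)"

lemma floor'_pos: "x > 0 \<Longrightarrow> floor' x = n \<longleftrightarrow> of_int n < x \<and> x \<le> of_int n + 1"
  unfolding floor'_def by simp linarith

lemma floor'_nonpos: "x \<le> 0 \<Longrightarrow> floor' x = n \<longleftrightarrow> of_int n \<le> x \<and> x < of_int n + 1"
  unfolding floor'_def by simp linarith

definition nearest_mult :: "nat \<Rightarrow> real \<Rightarrow> int" where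
  "nearest_mult q x = floor' (x / hecke_lambda q + 1 / 2)"

text \<open>The map \<open>f\<^sub>q\<close>, as a total function; only its values on \<open>I_q q\<close> are of interest.\<close>

definition f_q :: "nat \<Rightarrow> real \<Rightarrow> real" where
  "f_q q x = (if x = 0 then 0
     else - 1 / x - of_int (nearest_mult q (- 1 / x)) * hecke_lambda q)"

definition J_pos :: "nat \<Rightarrow> int \<Rightarrow> real set" where
  "J_pos q m =
    (if m = 1 then {- hecke_lambda q / 2 .. - 2 / (3 * hecke_lambda q)}
     else {- 2 / (of_int (2 * m - 1) * hecke_lambda q) .. - 2 / (of_int (2 * m + 1) * hecke_lambda q)})"

text \<open>The value at \<open>m = 0\<close> is junk; every use below is restricted to \<open>m \<noteq> 0\<close>.\<close>

definition J_int :: "nat \<Rightarrow> int \<Rightarrow> real set" where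
  "J_int q m = (if m > 0 then J_pos q m else uminus ` J_pos q (- m))"

definition boundary_J :: "nat \<Rightarrow> real set" where
  "boundary_J q =
    {x \<in> I_q q. \<exists>n. (f_q q ^^ n) x \<in> insert 0 (\<Union>m \<in> UNIV - {0}. frontier (J_int q m))}"

text \<open>
  Sequences \<open>(a\<^sub>1, a\<^sub>2, \<dots>)\<close> are functions on \<^typ>\<open>nat\<close> with \<open>a\<^sub>i\<close> stored
  at index \<open>i - 1\<close>, so the digit at index \<open>i\<close> is read off from the \<open>i\<close>-th iterate.
\<close>

definition pi_hat :: "nat \<Rightarrow> real \<Rightarrow> (nat \<Rightarrow> int)" where
  "pi_hat q x = (\<lambda>i. THE a. a \<noteq> 0 \<and> (f_q q ^^ i) x \<in> J_int q a)"

definition h_q :: "nat \<Rightarrow> nat" where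
  "h_q q = (if even q then (q - 2) div 2 else (q - 3) div 2)"

text \<open>Here \<open>s\<close> is the common sign of the entries of a block.\<close>

definition forbidden_blocks :: "nat \<Rightarrow> int list set" where
  "forbidden_blocks q =
    {replicate (h_q q + 1) s | s. s \<in> {1, -1}} \<union>
    (if even q
     then {replicate (h_q q) s @ [s * m] | s m. s \<in> {1, -1} \<and> m \<ge> 1}
     else {replicate (h_q q) s @ [s * 2] @ replicate (h_q q) s @ [s * m] | s m.
             s \<in> {1, -1} \<and> m \<ge> 1})"

definition A_reg :: "nat \<Rightarrow> (nat \<Rightarrow> int) set" where
  "A_reg q = {a. (\<forall>i. a i \<noteq> 0) \<and> (\<forall>l L. l < L \<longrightarrow> map a [l..<Suc L] \<notin> forbidden_blocks q)}"

fun lambda_cf :: "nat \<Rightarrow> int list \<Rightarrow> real" where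
  "lambda_cf q [] = 0"
| "lambda_cf q (a # as) = - 1 / (of_int a * hecke_lambda q + lambda_cf q as)"

end

theory Submission
  imports Defs
begin

text \<open>
  The left endpoint \<open>- \<lambda>\<^sub>q / 2\<close> has a finite expansion with digits \<open>d\<close>, namely \<open>(1)\<^sup>h\<close> for even
  \<open>q\<close> and \<open>(1)\<^sup>h, 2, (1)\<^sup>h\<close> for odd \<open>q\<close>, whose tails \<open>\<phi>\<^sub>j\<close> are quotients of sines. Apart from
  \<open>(1)\<^bsup>h+1\<^esup>\<close>, the forbidden blocks are exactly \<open>d\<close> followed by a digit of the same sign. All branches
  of \<open>f\<^sub>q\<close> are increasing, so a point whose digits start with \<open>d\<^sub>0, \<dots>, d\<^sub>j\<^sub>-\<^sub>1\<close> is mapped by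
  \<open>f\<^sub>q\<^sup>j\<close> to the right of \<open>\<phi>\<^sub>j\<close>; as the tail after all of \<open>d\<close> is \<open>0\<close>, the next digit is then negative.
  Conversely, a backward induction along a regular sequence shows that every finite convergent
  respects these bounds and hence lies in \<open>I\<^sub>q\<close>. There the inverse branches contract by
  \<open>(\<lambda>\<^sub>q / 2)\<^sup>2 < 1\<close>, which gives convergence and injectivity.
\<close>

section \<open>Rounding, and occurrences of blocks in a sequence\<close>

lemma floor'_bounds: "of_int (floor' x) \<le> x" "x \<le> of_int (floor' x) + 1"
  using floor'_pos[of x "floor' x"] floor'_nonpos[of x "floor' x"] by linarith+

lemma floor'_eqI: "of_int n < x \<Longrightarrow> x < of_int n + 1 \<Longrightarrow> floor' x = n"
  unfolding floor'_def by (auto simp: floor_eq_iff eq_diff_eq[symmetric] diff_eq_eq ceiling_eq_iff)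

text \<open>Windows with \<open>l < L\<close> are those with at least two entries, which matches
  \<open>2 \<le> length w\<close>. Block avoidance thus becomes a pointwise condition with a single
  starting index.\<close>

lemma ex_map_upt_eq_iff:
  assumes "2 \<le> length w"
  shows "(\<exists>l L. l < L \<and> map a [l..<Suc L] = w) \<longleftrightarrow> (\<exists>k. \<forall>i<length w. a (k + i) = w ! i)"
proof
  assume "\<exists>l L. l < L \<and> map a [l..<Suc L] = w"
  then obtain l L where "l < L" and w: "w = map a [l..<Suc L]" by blast
  then have "\<forall>i<length w. a (l + i) = w ! i" by (auto simp del: upt_Suc)
  then show "\<exists>k. \<forall>i<length w. a (k + i) = w ! i" by blast
next
  assume "\<exists>k. \<forall>i<length w. a (k + i) = w ! i"
  then obtain k where k: "\<forall>i<length w. a (k + i) = w ! i" by blast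
  have "map a [k..<Suc (k + length w - 1)] = w"
    using assms k by (intro nth_equalityI) (auto simp del: upt_Suc)
  moreover have "k < k + length w - 1" using assms by simp
  ultimately show "\<exists>l L. l < L \<and> map a [l..<Suc L] = w" by blast
qed

text \<open>The digits of the finite expansion of the left endpoint \<open>- \<lambda>\<^sub>q / 2\<close>.\<close>

definition endpoint_word :: "nat \<Rightarrow> int list" where
  "endpoint_word q =
    (if even q then replicate (h_q q) 1 else replicate (h_q q) 1 @ 2 # replicate (h_q q) 1)"

locale hecke =
  fixes q :: nat
  assumes q_ge: "4 \<le> q"
begin

abbreviation L :: real where "L \<equiv> hecke_lambda q"
abbreviation h :: nat where "h \<equiv> h_q q"
abbreviation d :: "int list" where "d \<equiv> endpoint_word q"
abbreviation N :: nat where "N \<equiv> length (endpoint_word q)"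
abbreviation \<phi> :: "nat \<Rightarrow> real" where "\<phi> j \<equiv> lambda_cf q (drop j (endpoint_word q))"
abbreviation \<theta> :: real where "\<theta> \<equiv> pi / real q"

section \<open>Size of the parameter \<open>L\<close>\<close>

lemma L_less: "L < 2"
proof -
  have "cos \<theta> < cos 0" using q_ge by (intro cos_monotone_0_pi) (auto simp: field_simps)
  then show ?thesis by (simp add: hecke_lambda_def)
qed

lemma L_sq: "2 \<le> L * L" and L_pos: "0 < L"
proof -
  \<comment> \<open>The angle \<open>pi / 4\<close> belongs to the extremal case
    \<open>q = 4\<close>, where \<open>L = sqrt 2\<close>.\<close>
  have "cos (pi / 4) \<le> cos \<theta>" using q_ge by (intro cos_monotone_0_pi_le) (auto simp: field_simps)
  then have 1: "sqrt 2 \<le> L" by (simp add: hecke_lambda_def cos_45)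
  then show "2 \<le> L * L" using mult_mono[OF 1 1] by (simp add: hecke_lambda_def)
  show "0 < L" using 1 by (meson less_le_trans real_sqrt_gt_zero zero_less_numeral)
qed

lemma L_gt_1: "1 < L"
proof (rule ccontr)
  assume "\<not> 1 < L"
  then have "L * L \<le> 1 * 1" using L_pos by (intro mult_mono) auto
  then show False using L_sq by simp
qed

text \<open>Nonzero points of \<open>I_q q\<close> have \<open>- 1 / x\<close> of modulus at least
  \<open>2 / L\<close>, so inversion carries them outside \<open>I_q q\<close>; this excludes the
  digit 0.\<close>

lemma L_half: "2 / L > L / 2"
proof -
  have "L * L < 4" using mult_strict_mono[OF L_less L_less] L_pos by simp
  then show ?thesis using L_pos by (simp add: field_simps)
qed

section \<open>Tails of the endpoint expansion as quotients of sines\<close>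

lemma q_h: "q = (if even q then 2 * h + 2 else 2 * h + 3)"
  using q_ge by (auto simp: h_q_def elim!: oddE evenE)

lemma h_pos: "1 \<le> h"
  using q_ge q_h by (simp split: if_splits)

lemma sin_recurrence: "sin (real (k + 2) * \<theta>) = L * sin (real (k + 1) * \<theta>) - sin (real k * \<theta>)"
proof -
  have "sin (real (k + 2) * \<theta>) = sin (real (k + 1) * \<theta> + \<theta>)"
    and "sin (real k * \<theta>) = sin (real (k + 1) * \<theta> - \<theta>)"
    by (simp_all add: algebra_simps add_divide_distrib)
  then show ?thesis unfolding sin_add sin_diff hecke_lambda_def by (simp add: algebra_simps)
qed

text \<open>Prefixing a digit 1 sends \<open>- p k / p (k + 1)\<close> to
  \<open>- 1 / (L - p k / p (k + 1))\<close>, which the recurrence turns into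
  \<open>- p (k + 1) / p (k + 2)\<close>. Leaving \<open>p\<close> and \<open>w\<close> open covers
  both kinds of tails: single sines with \<open>w\<close> empty, and sums of two neighbouring sines
  with \<open>w\<close> starting with 2.\<close>

lemma cf_ones_append:
  assumes "\<And>k. p (k + 2) = L * p (k + 1) - p k"
    and "lambda_cf q w = - p 0 / p 1"
    and "\<And>i. i \<le> k \<Longrightarrow> p (i + 1) > (0::real)"
  shows "lambda_cf q (replicate k 1 @ w) = - p k / p (k + 1)"
  using assms(3)
proof (induction k)
  case 0
  then show ?case using assms(2) by simp
next
  case (Suc k)
  have pos: "p (k + 1) > 0" "p (k + 2) > 0" using Suc.prems[of k] Suc.prems[of "Suc k"] by auto
  have IH: "lambda_cf q (replicate k 1 @ w) = - p k / p (k + 1)" using Suc by simp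
  have "lambda_cf q (replicate (Suc k) 1 @ w) = - 1 / (L + - p k / p (k + 1))"
    unfolding IH[symmetric] by simp
  also have "\<dots> = - p (k + 1) / p (k + 2)"
    using pos assms(1)[of k] by (simp add: field_simps)
  finally show ?case by simp
qed

lemma sin_multiple_pos: "0 < k \<Longrightarrow> k < q \<Longrightarrow> 0 < sin (real k * \<theta>)"
  using q_ge by (intro sin_gt_zero) (auto simp: field_simps)

lemma multiple_le_half_pi: "2 * k \<le> q \<Longrightarrow> real k * \<theta> \<le> pi / 2"
proof -
  assume "2 * k \<le> q"
  then have "2 * real k \<le> real q" by linarith
  then show ?thesis using q_ge by (simp add: field_simps)
qed

lemma cf_ones:
  assumes "k \<le> h"
  shows "lambda_cf q (replicate k 1) = - sin (real k * \<theta>) / sin (real (k + 1) * \<theta>)"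
proof -
  have "0 < sin (real (i + 1) * \<theta>)" if "i \<le> k" for i
    using that assms q_h by (intro sin_multiple_pos) (auto split: if_splits)
  then have "lambda_cf q (replicate k 1 @ []) = - sin (real k * \<theta>) / sin (real (k + 1) * \<theta>)"
    by (intro cf_ones_append sin_recurrence) simp_all
  then show ?thesis by simp
qed

lemma cf_ones_bounds:
  assumes "k \<le> h"
  shows "- 1 \<le> lambda_cf q (replicate k 1)" "lambda_cf q (replicate k 1) \<le> 0"
proof -
  have hq: "2 * (k + 1) \<le> q" using assms q_h by (simp split: if_splits)
  have pos: "0 < sin (real (k + 1) * \<theta>)" using hq by (intro sin_multiple_pos) auto
  have nn: "0 \<le> sin (real k * \<theta>)" using sin_multiple_pos[of k] hq by (cases "k = 0") auto
  have "0 \<le> real k * \<theta>" by simp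
  then have "- (pi / 2) \<le> real k * \<theta>" using pi_gt_zero by linarith
  \<comment> \<open>Both angles are at most \<open>pi / 2\<close> because
    \<open>2 * (k + 1) \<le> q\<close>, and sine increases there.\<close>
  then have "sin (real k * \<theta>) \<le> sin (real (k + 1) * \<theta>)"
    using multiple_le_half_pi[OF hq] by (intro sin_monotone_2pi_le) (auto intro!: divide_right_mono)
  then show "- 1 \<le> lambda_cf q (replicate k 1)" "lambda_cf q (replicate k 1) \<le> 0"
    using pos nn unfolding cf_ones[OF assms] by (auto simp: field_simps)
qed

lemma sin_reflect:
  assumes "m + n = q"
  shows "sin (real m * \<theta>) = sin (real n * \<theta>)"
proof -
  have "real m * \<theta> = pi - real n * \<theta>"
    using assms q_ge by (auto simp: field_simps)
  then show ?thesis by simp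
qed

text \<open>For odd \<open>q\<close> the indices \<open>h + 1\<close> and \<open>h + 2\<close> add
  up to \<open>q\<close>, so their sines coincide. The recurrence then gives the run of ones the
  value \<open>- (L - 1)\<close>, and the digit 2 yields the denominator
  \<open>2 * L - (L - 1)\<close>.\<close>

lemma cf_two_ones:
  assumes "odd q"
  shows "lambda_cf q (2 # replicate h 1) = - 1 / (L + 1)"
proof -
  have qh: "q = 2 * h + 3" using q_h assms by simp
  define A where "A = sin (real (h + 1) * \<theta>)"
  have A: "A > 0" unfolding A_def using qh by (intro sin_multiple_pos) auto
  have "sin (real (h + 2) * \<theta>) = A" unfolding A_def using qh by (intro sin_reflect) auto
  then have "sin (real h * \<theta>) = (L - 1) * A"
    using sin_recurrence[of h] unfolding A_def[symmetric] by (simp add: algebra_simps)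
  then have "lambda_cf q (replicate h 1) = - (L - 1)"
    using cf_ones[of h] A unfolding A_def[symmetric] by simp
  then show ?thesis by (simp add: algebra_simps)
qed

lemma cf_ones_two_ones:
  assumes "odd q" "k \<le> h"
  shows "lambda_cf q (replicate k 1 @ 2 # replicate h 1) =
    - (sin (real k * \<theta>) + sin (real (k + 1) * \<theta>)) / (sin (real (k + 1) * \<theta>) + sin (real (k + 2) * \<theta>))"
proof -
  let ?p = "\<lambda>k. sin (real k * \<theta>) + sin (real (k + 1) * \<theta>)"
  have qh: "q = 2 * h + 3" using q_h assms by simp
  have rec: "?p (k + 2) = L * ?p (k + 1) - ?p k" for k
    using sin_recurrence[of k] sin_recurrence[of "k + 1"] by (simp add: algebra_simps)
  have s1: "sin \<theta> > 0" using sin_multiple_pos[of 1] q_ge by simp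
  \<comment> \<open>The sums of neighbouring sines start with the ratio
    \<open>?p 0 / ?p 1 = 1 / (L + 1)\<close>, which is the one that the digit 2 followed by the ones
    requires.\<close>
  have "?p 1 = sin \<theta> * (L + 1)" using sin_recurrence[of 0] by (simp add: algebra_simps)
  then have "lambda_cf q (2 # replicate h 1) = - ?p 0 / ?p 1"
    unfolding cf_two_ones[OF assms(1)] using s1 by simp
  moreover have "?p (i + 1) > 0" if "i \<le> k" for i
    using sin_multiple_pos[of "i + 1"] sin_multiple_pos[of "i + 2"] that assms qh by simp
  ultimately have "lambda_cf q (replicate k 1 @ 2 # replicate h 1) = - ?p k / ?p (k + 1)"
    by (intro cf_ones_append[OF rec])
  then show ?thesis by (simp add: add.commute)
qed

lemma cf_ones_two_ones_bounds:
  assumes "odd q" "k \<le> h"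
  shows "- 1 \<le> lambda_cf q (replicate k 1 @ 2 # replicate h 1)"
    "lambda_cf q (replicate k 1 @ 2 # replicate h 1) \<le> 0"
proof -
  have qh: "q = 2 * h + 3" using q_h assms by simp
  let ?s = "\<lambda>k. sin (real k * \<theta>)"
  have pos: "?s (k + 1) > 0" "?s (k + 2) > 0"
    using assms qh by (intro sin_multiple_pos; simp)+
  have nn: "0 \<le> ?s k" using sin_multiple_pos[of k] assms qh by (cases "k = 0") auto
  \<comment> \<open>The term \<open>?s (k + 1)\<close> occurs in numerator and denominator, so the
    bound \<open>- 1\<close> amounts to \<open>?s k \<le> ?s (k + 2)\<close>.\<close>
  have "?s (k + 2) - ?s k = 2 * cos (real (k + 1) * \<theta>) * sin \<theta>"
  proof -
    have "?s (k + 2) = sin (real (k + 1) * \<theta> + \<theta>)" and "?s k = sin (real (k + 1) * \<theta> - \<theta>)"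
      by (simp_all add: algebra_simps add_divide_distrib)
    then show ?thesis unfolding sin_add sin_diff by simp
  qed
  moreover have "0 \<le> cos (real (k + 1) * \<theta>)"
  proof (rule cos_ge_zero)
    show "real (k + 1) * \<theta> \<le> pi / 2" using assms qh by (intro multiple_le_half_pi) simp
    have "0 \<le> real (k + 1) * \<theta>" by simp
    then show "- (pi / 2) \<le> real (k + 1) * \<theta>" using pi_gt_zero by linarith
  qed
  moreover have "sin \<theta> > 0" using sin_multiple_pos[of 1] q_ge by simp
  ultimately have "?s k \<le> ?s (k + 2)"
    by (metis diff_ge_0_iff_ge less_imp_le mult_nonneg_nonneg zero_le_numeral)
  then show "- 1 \<le> lambda_cf q (replicate k 1 @ 2 # replicate h 1)"
    "lambda_cf q (replicate k 1 @ 2 # replicate h 1) \<le> 0"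
    unfolding cf_ones_two_ones[OF assms] using pos nn by (auto simp: divide_simps)
qed

lemma drop_endpoint_word:
  assumes "j \<le> N"
  shows "(\<exists>k\<le>h. drop j d = replicate k 1) \<or>
    odd q \<and> (\<exists>k\<le>h. drop j d = replicate k 1 @ 2 # replicate h 1)"
proof (cases "even q")
  case True
  then show ?thesis by (intro disjI1 exI[of _ "h - j"]) (simp add: endpoint_word_def)
next
  case False
  show ?thesis
  proof (cases "j \<le> h")
    case True
    then show ?thesis using False
      by (intro disjI2 conjI exI[of _ "h - j"]) (simp_all add: endpoint_word_def)
  next
    case j: False
    then obtain i where "j = h + Suc i" by (metis add_Suc_right less_iff_Suc_add not_le)
    then show ?thesis using False assms
      by (intro disjI1 exI[of _ "h - i"]) (simp add: endpoint_word_def)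
  qed
qed

text \<open>Together with \<open>1 < L\<close>, the lower bound keeps all denominators along the
  endpoint expansion positive. The upper bound starts the induction for the convergents.\<close>

lemma phi_bounds:
  assumes "j \<le> N"
  shows "- 1 \<le> \<phi> j" "\<phi> j \<le> 0"
  using drop_endpoint_word[OF assms] cf_ones_bounds cf_ones_two_ones_bounds by fastforce+

text \<open>For even \<open>q\<close> the angle \<open>(h + 1) * \<theta>\<close> is
  \<open>pi / 2\<close>, so the quotient is \<open>- cos \<theta>\<close>. For odd \<open>q\<close>
  the two middle sines have a common value \<open>A\<close>, and the quotient is
  \<open>- ((L - 1) * A + A) / (2 * A)\<close>.\<close>

lemma phi_0: "\<phi> 0 = - L / 2"
proof (cases "even q")
  case True
  then have qh: "q = 2 * (h + 1)" using q_h by simp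
  then have "real q = 2 * real (h + 1)" by linarith
  then have pi2: "real (h + 1) * \<theta> = pi / 2" using q_ge by (simp add: field_simps)
  have "real h * \<theta> = pi / 2 - \<theta>" using pi2 by (simp add: algebra_simps)
  then have "sin (real h * \<theta>) = L / 2" by (simp add: sin_diff hecke_lambda_def)
  moreover have "sin (real (h + 1) * \<theta>) = 1" unfolding pi2 by simp
  ultimately show ?thesis using True cf_ones[of h] by (simp add: endpoint_word_def)
next
  case False
  then have qh: "q = 2 * h + 3" using q_h by simp
  define A where "A = sin (real (h + 1) * \<theta>)"
  have A: "A > 0" unfolding A_def using qh by (intro sin_multiple_pos) auto
  have s2: "sin (real (h + 2) * \<theta>) = A" unfolding A_def using qh by (intro sin_reflect) auto
  then have "sin (real h * \<theta>) = (L - 1) * A"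
    using sin_recurrence[of h] unfolding A_def[symmetric] by (simp add: algebra_simps)
  then show ?thesis
    using cf_ones_two_ones[OF False order_refl] False A s2 unfolding A_def[symmetric]
    by (simp add: endpoint_word_def field_simps)
qed

lemma phi_step: "j < N \<Longrightarrow> \<phi> j = - 1 / (of_int (d ! j) * L + \<phi> (Suc j))"
  by (metis Cons_nth_drop_Suc lambda_cf.simps(2))

lemma endpoint_word_nth:
  assumes "j < N"
  shows "d ! j = 1 \<or> d ! j = 2 \<and> odd q \<and> j = h"
  using assms by (auto simp: endpoint_word_def nth_append nth_Cons' split: if_splits)

lemma endpoint_word_nth_ones: "j < h \<Longrightarrow> d ! j = 1"
  by (auto simp: endpoint_word_def nth_append)

lemma h_le_N: "h \<le> N"
  by (auto simp: endpoint_word_def)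

section \<open>Forbidden blocks and regular sequences\<close>

lemma forbidden_blocks_eq:
  "forbidden_blocks q = {replicate (h + 1) s | s. s \<in> {1, -1}} \<union>
    {map ((*) s) d @ [s * m] | s m. s \<in> {1, -1} \<and> m \<ge> 1}"
  unfolding forbidden_blocks_def endpoint_word_def by auto

text \<open>The inequality \<open>s * a (k + N) < 1\<close> excludes all final entries
  \<open>s * m\<close> with \<open>m \<ge> 1\<close> at once, because \<open>s * s = 1\<close>. Both
  parities of \<open>q\<close> and both signs are covered by one formula.\<close>

lemma A_reg_iff:
  "a \<in> A_reg q \<longleftrightarrow> (\<forall>i. a i \<noteq> 0) \<and>
    (\<forall>k s. s \<in> {1, -1} \<longrightarrow> \<not> (\<forall>i\<le>h. a (k + i) = s) \<and>
      ((\<forall>i<N. a (k + i) = s * d ! i) \<longrightarrow> s * a (k + N) < 1))"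
proof -
  have len: "2 \<le> length w" if "w \<in> forbidden_blocks q" for w
    using that h_pos h_le_N unfolding forbidden_blocks_eq by auto
  have "(\<forall>l L. l < L \<longrightarrow> map a [l..<Suc L] \<notin> forbidden_blocks q) \<longleftrightarrow>
    (\<forall>w \<in> forbidden_blocks q. \<not> (\<exists>l L. l < L \<and> map a [l..<Suc L] = w))"
    by blast
  also have "\<dots> \<longleftrightarrow> (\<forall>w \<in> forbidden_blocks q. \<not> (\<exists>k. \<forall>i<length w. a (k + i) = w ! i))"
    by (intro ball_cong refl arg_cong[where f = Not] ex_map_upt_eq_iff len)
  also have "\<dots> \<longleftrightarrow> (\<forall>k s. s \<in> {1, -1} \<longrightarrow> \<not> (\<forall>i\<le>h. a (k + i) = s) \<and>
      (\<forall>m\<ge>1. \<not> ((\<forall>i<N. a (k + i) = s * d ! i) \<and> a (k + N) = s * m)))"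
  proof -
    have 1: "(\<forall>i<length (replicate (h + 1) s). a (k + i) = replicate (h + 1) s ! i) \<longleftrightarrow>
      (\<forall>i\<le>h. a (k + i) = s)" for k s
      by (auto simp: less_Suc_eq_le simp del: replicate_Suc)
    have 2: "(\<forall>i<length (map ((*) s) d @ [s * m]). a (k + i) = (map ((*) s) d @ [s * m]) ! i) \<longleftrightarrow>
      (\<forall>i<N. a (k + i) = s * d ! i) \<and> a (k + N) = s * m" for k s m
      by (auto simp: less_Suc_eq nth_append)
    have "(\<forall>w \<in> forbidden_blocks q. \<not> (\<exists>k. P k w)) \<longleftrightarrow> (\<forall>k s. s \<in> {1, -1} \<longrightarrow>
      \<not> P k (replicate (h + 1) s) \<and> (\<forall>m\<ge>1. \<not> P k (map ((*) s) d @ [s * m])))" for P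
      unfolding forbidden_blocks_eq by blast
    from this[of "\<lambda>k w. \<forall>i<length w. a (k + i) = w ! i"] show ?thesis
      unfolding 1 2 .
  qed
  also have "\<dots> \<longleftrightarrow> (\<forall>k s. s \<in> {1, -1} \<longrightarrow> \<not> (\<forall>i\<le>h. a (k + i) = s) \<and>
      ((\<forall>i<N. a (k + i) = s * d ! i) \<longrightarrow> s * a (k + N) < 1))"
  proof -
    have "(\<forall>m\<ge>1. \<not> (P \<and> b = s * m)) \<longleftrightarrow> (P \<longrightarrow> s * b < 1)" if "s \<in> {1, -1}" for s b :: int and P
    proof -
      have "b = s * m \<longleftrightarrow> s * b = m" for m using that by auto
      then show ?thesis by (auto simp: not_less[symmetric])
    qed
    from this[of s "\<forall>i<N. a (k + i) = s * d ! i" "a (k + N)" for s k] show ?thesis by meson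
  qed
  finally show ?thesis unfolding A_reg_def by simp
qed

lemma A_reg_nonzero: "a \<in> A_reg q \<Longrightarrow> a i \<noteq> 0"
  unfolding A_reg_iff by blast

lemma A_reg_shift: "a \<in> A_reg q \<Longrightarrow> (\<lambda>i. a (k + i)) \<in> A_reg q"
  unfolding A_reg_iff by (simp only: add.assoc[symmetric]) blast

text \<open>The only entry of \<open>d\<close> above 1 is the 2 at index \<open>h\<close> for odd
  \<open>q\<close>; a digit 1 in its place would complete a forbidden run of \<open>h + 1\<close>
  equal digits.\<close>

lemma A_reg_digit_ge:
  assumes "a \<in> A_reg q" "s \<in> {1, -1}" "j < N" "\<forall>i<j. a (k + i) = s * d ! i" "1 \<le> s * a (k + j)"
  shows "d ! j \<le> s * a (k + j)"
proof (rule ccontr)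
  assume neg: "\<not> ?thesis"
  then have j: "j = h" and 1: "s * a (k + h) = 1" using endpoint_word_nth[OF assms(3)] assms(5) by auto
  have "a (k + i) = s" if "i \<le> h" for i
    using that assms(2,4) 1 endpoint_word_nth_ones[of i] unfolding j
    by (cases "i = h") auto
  then show False using assms(1,2) unfolding A_reg_iff by blast
qed

lemma A_reg_digit_neg:
  assumes "a \<in> A_reg q" "s \<in> {1, -1}" "\<forall>i<N. a (k + i) = s * d ! i"
  shows "s * a (k + N) \<le> -1"
proof -
  have "s * a (k + N) < 1" using assms unfolding A_reg_iff by blast
  moreover have "s * a (k + N) \<noteq> 0" using A_reg_nonzero[OF assms(1)] assms(2) by auto
  ultimately show ?thesis by linarith
qed

section \<open>Inverse branches compared with the endpoint tails\<close>

lemma branch_denominator: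
  assumes "m \<noteq> 0" "\<bar>y\<bar> \<le> L / 2"
  shows "of_int m * L + y \<noteq> 0" "of_int m * L + y > 0 \<longleftrightarrow> m > 0"
proof -
  consider "m \<ge> 1" | "m \<le> -1" using assms(1) by linarith
  then have "m > 0 \<and> of_int m * L + y > 0 \<or> m < 0 \<and> of_int m * L + y < 0"
  proof cases
    case 1
    then have "1 * L \<le> of_int m * L" using L_pos by (intro mult_right_mono) auto
    then show ?thesis using assms(2) 1 L_pos by linarith
  next
    case 2
    then have "of_int m * L \<le> (-1) * L" using L_pos by (intro mult_right_mono) auto
    then show ?thesis using assms(2) 2 L_pos by linarith
  qed
  then show "of_int m * L + y \<noteq> 0" "of_int m * L + y > 0 \<longleftrightarrow> m > 0" by auto
qed

lemma phi_denominator: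
  assumes "j < N"
  shows "0 < of_int (d ! j) * L + \<phi> (Suc j)"
proof -
  have "1 * L \<le> of_int (d ! j) * L"
    using endpoint_word_nth[OF assms] L_pos by (intro mult_right_mono) auto
  then show ?thesis using phi_bounds[of "Suc j"] assms L_gt_1 by linarith
qed

text \<open>The branch with digit \<open>d ! j\<close> is increasing where its denominator is
  positive, and it maps \<open>\<phi> (Suc j)\<close> to \<open>\<phi> j\<close>.\<close>

lemma phi_branch_iff:
  assumes "j < N" "\<bar>y\<bar> \<le> L / 2"
  shows "\<phi> j \<le> - 1 / (of_int (d ! j) * L + y) \<longleftrightarrow> \<phi> (Suc j) \<le> y"
    and "\<phi> j < - 1 / (of_int (d ! j) * L + y) \<longleftrightarrow> \<phi> (Suc j) < y"
proof -
  have D: "0 < of_int (d ! j) * L + \<phi> (Suc j)" by (rule phi_denominator[OF assms(1)])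
  have "0 < d ! j" using endpoint_word_nth[OF assms(1)] by auto
  then have "0 < of_int (d ! j) * L + y" using branch_denominator[of "d ! j", OF _ assms(2)] by simp
  then show "\<phi> j \<le> - 1 / (of_int (d ! j) * L + y) \<longleftrightarrow> \<phi> (Suc j) \<le> y"
    and "\<phi> j < - 1 / (of_int (d ! j) * L + y) \<longleftrightarrow> \<phi> (Suc j) < y"
    using D unfolding phi_step[OF assms(1)] by (auto simp: divide_simps)
qed

text \<open>A negative \<open>m\<close> gives a positive value, whereas \<open>\<phi> j < 0\<close>.
  A digit above \<open>d ! j\<close> adds at least \<open>L\<close> to the denominator, while
  replacing \<open>\<phi> (Suc j) \<le> 0\<close> by \<open>y\<close> lowers it by at most
  \<open>L / 2\<close>.\<close>

lemma phi_less_branch: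
  assumes "j < N" "m \<noteq> 0" "\<bar>y\<bar> \<le> L / 2" "1 \<le> m \<Longrightarrow> d ! j \<le> m" "m \<noteq> d ! j"
  shows "\<phi> j < - 1 / (of_int m * L + y)"
proof -
  have D: "0 < of_int (d ! j) * L + \<phi> (Suc j)" (is "0 < ?D") by (rule phi_denominator[OF assms(1)])
  have phi: "\<phi> j = - 1 / ?D" by (rule phi_step[OF assms(1)])
  show ?thesis
  proof (cases "m > 0")
    case False
    then have "of_int m * L + y < 0"
      using branch_denominator[OF assms(2,3)] by linarith
    then have "0 < - 1 / (of_int m * L + y)" by (simp add: divide_neg_neg)
    moreover have "\<phi> j < 0" unfolding phi using D by simp
    ultimately show ?thesis by linarith
  next
    case True
    then have "real_of_int (d ! j) + 1 \<le> of_int m" using assms(4,5) by linarith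
    then have "(real_of_int (d ! j) + 1) * L \<le> of_int m * L"
      using L_pos by (intro mult_right_mono) auto
    then have "?D < of_int m * L + y"
      using phi_bounds[of "Suc j"] assms(1,3) L_pos by (simp add: algebra_simps)
    then show ?thesis unfolding phi using D by (simp add: divide_simps)
  qed
qed

text \<open>Branches are odd in digit and argument together, so the right endpoint is the left one
  seen through \<open>s = -1\<close>.\<close>

lemma sign_branch:
  assumes "s \<in> {1, -1 :: int}"
  shows "of_int s * (- 1 / (of_int m * L + y)) = - 1 / (of_int (s * m) * L + of_int s * y)"
  using assms by (auto simp: divide_simps)

section \<open>Bounds for the convergents of a regular sequence\<close>

lemma cf_upt: "k < n \<Longrightarrow>
  lambda_cf q (map a [k..<n]) = - 1 / (of_int (a k) * L + lambda_cf q (map a [Suc k..<n]))"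
  by (simp add: upt_conv_Cons)

text \<open>Backward induction on the starting index, for both signs and all matched prefixes of
  \<open>s * d\<close> simultaneously: the prefix of length \<open>j\<close> ends just before index
  \<open>k\<close>.\<close>

lemma phi_le_cf:
  assumes a: "a \<in> A_reg q" and "k \<le> n"
  shows "\<forall>s\<in>{1, -1}. \<forall>j\<le>N. \<forall>l. l + j = k \<longrightarrow> (\<forall>i<j. a (l + i) = s * d ! i) \<longrightarrow>
    \<phi> j \<le> of_int s * lambda_cf q (map a [k..<n])"
  using assms(2)
proof (induction k rule: inc_induct)
  case base
  then show ?case using phi_bounds by simp
next
  case (step k)
  define y where "y = lambda_cf q (map a [Suc k..<n])"
  \<comment> \<open>The empty prefix, taken with both signs, puts the next tail into
    \<open>I_q q\<close>, as the branch lemmas require.\<close>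
  have "\<phi> 0 \<le> of_int s * y" if "s \<in> {1, -1}" for s :: int
    using step.IH that unfolding y_def by fastforce
  from this[of 1] this[of "-1"] have y: "\<bar>y\<bar> \<le> L / 2" unfolding phi_0 by simp
  show ?case
  proof (intro ballI allI impI)
    fix s :: int and j l
    assume s: "s \<in> {1, -1}" and j: "j \<le> N" and l: "l + j = k" and pre: "\<forall>i<j. a (l + i) = s * d ! i"
    let ?m = "s * a k"
    have v: "of_int s * lambda_cf q (map a [k..<n]) = - 1 / (of_int ?m * L + of_int s * y)"
      using cf_upt[OF step.hyps(2)] sign_branch[OF s] unfolding y_def by simp
    have m0: "?m \<noteq> 0" using A_reg_nonzero[OF a] s by auto
    have sy: "\<bar>of_int s * y\<bar> \<le> L / 2" using y s by auto
    show "\<phi> j \<le> of_int s * lambda_cf q (map a [k..<n])"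
    proof (cases "j = N")
      case True
      \<comment> \<open>After all of \<open>d\<close> the bound is \<open>\<phi> N = 0\<close>, and
        regularity forces a digit of the opposite sign.\<close>
      then have "?m < 0" using A_reg_digit_neg[OF a s] pre l by force
      then have "of_int ?m * L + of_int s * y < 0" using branch_denominator[OF m0 sy] by linarith
      then show ?thesis unfolding v using True by (simp add: divide_nonpos_neg)
    next
      case False
      then have "j < N" using j by simp
      show ?thesis unfolding v
      proof (cases "?m = d ! j")
        case True
        \<comment> \<open>An agreeing digit lengthens the matched prefix, so the induction
          hypothesis applies with \<open>Suc j\<close>.\<close>
        then have "a k = s * d ! j" using s by auto
        then have "\<forall>i<Suc j. a (l + i) = s * d ! i" using pre l by (auto simp: less_Suc_eq)
        then have "\<phi> (Suc j) \<le> of_int s * y"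
          using step.IH s \<open>j < N\<close> l unfolding y_def by (metis Suc_leI add_Suc_right)
        then show "\<phi> j \<le> - 1 / (of_int ?m * L + of_int s * y)"
          unfolding True phi_branch_iff(1)[OF \<open>j < N\<close> sy] .
      next
        case False
        moreover have "d ! j \<le> ?m" if "1 \<le> ?m"
          using A_reg_digit_ge[OF a s \<open>j < N\<close> pre] that l by simp
        ultimately show "\<phi> j \<le> - 1 / (of_int ?m * L + of_int s * y)"
          using phi_less_branch[OF \<open>j < N\<close> m0 sy] by (intro less_imp_le) blast
      qed
    qed
  qed
qed

lemma abs_cf_le:
  assumes "a \<in> A_reg q" "k \<le> n"
  shows "\<bar>lambda_cf q (map a [k..<n])\<bar> \<le> L / 2"
proof -
  have "\<phi> 0 \<le> of_int s * lambda_cf q (map a [k..<n])" if "s \<in> {1, -1}" for s :: int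
    using phi_le_cf[OF assms] that by fastforce
  from this[of 1] this[of "-1"] show ?thesis unfolding phi_0 by simp
qed

section \<open>Contraction, convergence and limit tails\<close>

lemma branch_contraction:
  assumes "\<And>i. i < n \<Longrightarrow> a i \<noteq> 0"
    and "\<And>i. i < n \<Longrightarrow> x i = - 1 / (of_int (a i) * L + x (Suc i))"
    and "\<And>i. i < n \<Longrightarrow> y i = - 1 / (of_int (a i) * L + y (Suc i))"
    and "\<And>i. i \<le> n \<Longrightarrow> \<bar>x i\<bar> \<le> L / 2"
    and "\<And>i. i \<le> n \<Longrightarrow> \<bar>y i\<bar> \<le> L / 2"
  shows "\<bar>x 0 - y 0\<bar> \<le> (L\<^sup>2 / 4) ^ n * \<bar>x n - y n\<bar>"
  using assms
proof (induction n)
  case 0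
  then show ?case by simp
next
  case (Suc n)
  have IH: "\<bar>x 0 - y 0\<bar> \<le> (L\<^sup>2 / 4) ^ n * \<bar>x n - y n\<bar>"
    by (rule Suc.IH[OF Suc.prems(1)[OF less_SucI] Suc.prems(2)[OF less_SucI] Suc.prems(3)[OF less_SucI]
          Suc.prems(4)[OF le_SucI] Suc.prems(5)[OF le_SucI]])
  let ?A = "of_int (a n) * L + x (Suc n)" and ?B = "of_int (a n) * L + y (Suc n)"
  have "?A \<noteq> 0" "?B \<noteq> 0"
    by (rule branch_denominator(1)[OF Suc.prems(1)[OF lessI]] Suc.prems(4,5)[OF order_refl])+
  moreover have x: "x n = - 1 / ?A" and y: "y n = - 1 / ?B"
    by (rule Suc.prems(2,3)[OF lessI])+
  \<comment> \<open>Two values of one branch differ by the product of both values times the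
    difference of the arguments; each value is at most \<open>L / 2\<close> in modulus.\<close>
  ultimately have "x n - y n = x n * y n * (x (Suc n) - y (Suc n))"
    unfolding x y by (simp add: field_simps)
  then have "\<bar>x n - y n\<bar> = \<bar>x n\<bar> * \<bar>y n\<bar> * \<bar>x (Suc n) - y (Suc n)\<bar>" by (simp add: abs_mult)
  also have "\<dots> \<le> (L / 2) * (L / 2) * \<bar>x (Suc n) - y (Suc n)\<bar>"
    using Suc.prems(4)[of n] Suc.prems(5)[of n] L_pos by (intro mult_right_mono mult_mono) auto
  finally have "(L\<^sup>2 / 4) ^ n * \<bar>x n - y n\<bar> \<le> (L\<^sup>2 / 4) ^ n * (L\<^sup>2 / 4 * \<bar>x (Suc n) - y (Suc n)\<bar>)"
    by (intro mult_left_mono) (auto simp: power2_eq_square)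
  from order_trans[OF IH this] show ?case by (simp add: mult.assoc mult.left_commute)
qed

lemma contraction_tendsto: "(\<lambda>n. (L\<^sup>2 / 4) ^ n * L) \<longlonglongrightarrow> 0"
proof -
  have "L\<^sup>2 / 4 < 1" using mult_strict_mono[OF L_less L_less] L_pos by (simp add: power2_eq_square)
  then have "(\<lambda>n. (L\<^sup>2 / 4) ^ n) \<longlonglongrightarrow> 0" by (intro LIMSEQ_power_zero) simp
  then show ?thesis by (intro tendsto_mult_left_zero)
qed

lemma cf_convergent:
  assumes "a \<in> A_reg q"
  shows "convergent (\<lambda>n. lambda_cf q (map a [0..<n]))"
proof -
  let ?z = "\<lambda>n k. lambda_cf q (map a [k..<n])"
  have bound: "\<bar>?z n 0 - ?z m 0\<bar> \<le> (L\<^sup>2 / 4) ^ n * L" if "n \<le> m" for n m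
  proof -
    \<comment> \<open>Both convergents pass through the same first \<open>n\<close> branches, ending
      in the tails \<open>0\<close> and \<open>?z m n\<close>.\<close>
    have "\<bar>?z n 0 - ?z m 0\<bar> \<le> (L\<^sup>2 / 4) ^ n * \<bar>?z n n - ?z m n\<bar>"
    proof (rule branch_contraction[where a = a])
      show "?z n i = - 1 / (of_int (a i) * L + ?z n (Suc i))"
        "?z m i = - 1 / (of_int (a i) * L + ?z m (Suc i))" if "i < n" for i
        using cf_upt that \<open>n \<le> m\<close> by simp_all
      show "\<bar>?z n i\<bar> \<le> L / 2" "\<bar>?z m i\<bar> \<le> L / 2" if "i \<le> n" for i
        using abs_cf_le[OF assms] that \<open>n \<le> m\<close> by (meson order_trans)+
    qed (rule A_reg_nonzero[OF assms])
    also have "\<dots> \<le> (L\<^sup>2 / 4) ^ n * L"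
      using abs_cf_le[OF assms that] L_pos by (intro mult_left_mono) auto
    finally show ?thesis .
  qed
  have "Cauchy (\<lambda>n. ?z n 0)"
  proof (rule metric_CauchyI)
    fix e :: real assume "0 < e"
    then have "eventually (\<lambda>n. (L\<^sup>2 / 4) ^ n * L < e / 2) sequentially"
      by (intro order_tendstoD(2)[OF contraction_tendsto]) simp
    then obtain M where M: "(L\<^sup>2 / 4) ^ M * L < e / 2" by (auto simp: eventually_sequentially)
    have "dist (?z m 0) (?z n 0) < e" if "M \<le> m" "M \<le> n" for m n
      using bound[OF that(1)] bound[OF that(2)] M by (simp add: dist_real_def)
    then show "\<exists>M. \<forall>m\<ge>M. \<forall>n\<ge>M. dist (?z m 0) (?z n 0) < e" by blast
  qed
  then show ?thesis by (rule Cauchy_convergent)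
qed

lemma cf_limits:
  assumes "a \<in> A_reg q"
  obtains x where "(\<lambda>n. lambda_cf q (map a [0..<n])) \<longlonglongrightarrow> x 0"
    and "\<And>k. x k = - 1 / (of_int (a k) * L + x (Suc k))"
    and "\<And>k. \<bar>x k\<bar> \<le> L / 2"
proof -
  let ?z = "\<lambda>n k. lambda_cf q (map a [k..<k + n])"
  have "\<exists>x. (\<lambda>n. ?z n k) \<longlonglongrightarrow> x" for k
  proof -
    have "map (\<lambda>i. a (k + i)) [0..<n] = map a [k..<k + n]" for n
      by (intro nth_equalityI) auto
    then show ?thesis using cf_convergent[OF A_reg_shift[OF assms, of k]] by (simp add: convergent_def)
  qed
  then obtain x where x: "\<And>k. (\<lambda>n. ?z n k) \<longlonglongrightarrow> x k" by metis
  have b: "\<bar>x k\<bar> \<le> L / 2" for k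
    by (rule LIMSEQ_le_const2[OF tendsto_rabs[OF x]]) (intro exI allI impI abs_cf_le[OF assms] le_add1)
  have rec: "x k = - 1 / (of_int (a k) * L + x (Suc k))" for k
  proof (rule LIMSEQ_unique)
    \<comment> \<open>A convergent of length \<open>Suc n\<close> from \<open>k\<close> is one
      branch applied to the convergent of length \<open>n\<close> from \<open>Suc k\<close>.\<close>
    show "(\<lambda>n. ?z (Suc n) k) \<longlonglongrightarrow> x k" by (rule LIMSEQ_Suc[OF x])
    have "?z (Suc n) k = - 1 / (of_int (a k) * L + ?z n (Suc k))" for n
      using cf_upt[of k "k + Suc n" a] by simp
    moreover have "(\<lambda>n. - 1 / (of_int (a k) * L + ?z n (Suc k))) \<longlonglongrightarrow> - 1 / (of_int (a k) * L + x (Suc k))"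
      by (intro tendsto_intros x branch_denominator A_reg_nonzero[OF assms] b)
    ultimately show "(\<lambda>n. ?z (Suc n) k) \<longlonglongrightarrow> - 1 / (of_int (a k) * L + x (Suc k))"
      by (simp only:)
  qed
  have "(\<lambda>n. lambda_cf q (map a [0..<n])) \<longlonglongrightarrow> x 0" using x[of 0] by simp
  from this rec b show ?thesis by (rule that)
qed

text \<open>A tail equal to an endpoint would have to follow the finite endpoint expansion and reach \<open>0\<close>.\<close>

lemma tail_not_endpoint:
  assumes a: "a \<in> A_reg q"
    and x: "\<And>k. x k = - 1 / (of_int (a k) * L + x (Suc k))"
    and b: "\<And>k. \<bar>x k\<bar> \<le> L / 2"
  shows "\<bar>x k\<bar> < L / 2"
proof (rule ccontr)
  assume "\<not> ?thesis"
  then have "\<bar>x k\<bar> = L / 2" using b[of k] by simp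
  \<comment> \<open>The sign is chosen so that \<open>s * x k\<close> is the left endpoint
    \<open>\<phi> 0\<close>.\<close>
  define s :: int where "s = (if x k < 0 then 1 else -1)"
  have s: "s \<in> {1, -1}" by (simp add: s_def)
  have xs: "of_int s * x k = - L / 2" using \<open>\<bar>x k\<bar> = L / 2\<close> by (auto simp: s_def)
  let ?sx = "\<lambda>i. of_int s * x i"
  have sx: "?sx i = - 1 / (of_int (s * a i) * L + ?sx (Suc i))" for i
    using x sign_branch[OF s] by metis
  have sb: "\<bar>?sx i\<bar> \<le> L / 2" for i using b[of i] s by auto
  have sa: "s * a i \<noteq> 0" for i using A_reg_nonzero[OF a] s by auto
  have xnz: "x i \<noteq> 0" for i
    using branch_denominator[OF A_reg_nonzero[OF a] b] by (subst x) simp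
  \<comment> \<open>Equality with \<open>\<phi> j\<close> forces the digit \<open>d ! j\<close>,
    since every other admissible digit gives a strictly larger value.\<close>
  have "(\<forall>i<j. a (k + i) = s * d ! i) \<and> ?sx (k + j) = \<phi> j" if "j \<le> N" for j
    using that
  proof (induction j)
    case 0
    then show ?case using xs phi_0 by simp
  next
    case (Suc j)
    then have j: "j < N" and pre: "\<forall>i<j. a (k + i) = s * d ! i" and eq: "?sx (k + j) = \<phi> j" by auto
    have "d ! j \<le> s * a (k + j)" if "1 \<le> s * a (k + j)"
      using A_reg_digit_ge[OF a s j pre that] .
    then have m: "s * a (k + j) = d ! j"
      using phi_less_branch[OF j sa sb[of "Suc (k + j)"]] eq sx[of "k + j"] by fastforce
    then have "a (k + j) = s * d ! j" using s by auto
    moreover have "?sx (Suc (k + j)) = \<phi> (Suc j)"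
      using phi_branch_iff[OF j sb[of "Suc (k + j)"]] eq sx[of "k + j"] unfolding m by linarith
    ultimately show ?case using pre by (auto simp: less_Suc_eq)
  qed
  from this[of N] have "?sx (k + N) = 0" by simp
  then show False using xnz s by auto
qed

section \<open>The intervals \<open>J_int q m\<close> in the coordinate
  \<open>- 1 / x\<close>\<close>

lemma mem_I_q: "x \<in> I_q q \<longleftrightarrow> \<bar>x\<bar> \<le> L / 2"
  unfolding I_q_def by auto

lemma neg_recip_compare:
  fixes x c :: real
  assumes "x < 0" "0 < c"
  shows "- 2 / c \<le> x \<longleftrightarrow> c \<le> 2 * (- 1 / x)" "x \<le> - 2 / c \<longleftrightarrow> 2 * (- 1 / x) \<le> c"
    "x = - 2 / c \<longleftrightarrow> 2 * (- 1 / x) = c"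
  using assms by (auto simp: field_simps)

text \<open>In the coordinate \<open>- 1 / x\<close> the intervals have radius \<open>L / 2\<close>
  around multiples of \<open>L\<close>, except that the first is cut off at the end of
  \<open>I_q q\<close>.\<close>

lemma J_pos_iff:
  assumes "1 \<le> m"
  shows "x \<in> J_pos q m \<longleftrightarrow> x < 0 \<and> - L / 2 \<le> x \<and> \<bar>- 1 / x - of_int m * L\<bar> \<le> L / 2" (is ?iff)
    and "x \<in> frontier (J_pos q m) \<longleftrightarrow>
      x \<in> J_pos q m \<and> (x = - L / 2 \<or> \<bar>- 1 / x - of_int m * L\<bar> = L / 2)" (is ?frontier)
proof -
  have fr: "x \<in> frontier {u..v} \<longleftrightarrow> x \<in> {u..v} \<and> (x = u \<or> x = v)" for u v :: real
    by (auto simp: frontier_def)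
  have neg_side: "x < 0" if "x \<le> - 2 / c" "0 < c" for c :: real
    by (rule order.strict_trans1[OF that(1)]) (use that(2) in simp)
  \<comment> \<open>For \<open>m = 1\<close> the cut at \<open>- L / 2\<close> implies the lower
    half of the distance condition, with strict inequality.\<close>
  have below: "L / 2 < - 1 / x" if "x < 0" "- L / 2 \<le> x"
  proof -
    have "2 / L \<le> - 1 / x" using that L_pos by (simp add: field_simps)
    then show ?thesis using L_half by linarith
  qed
  have "?iff \<and> ?frontier"
  proof (cases "m = 1")
    case True
    have J: "x \<in> J_pos q m \<longleftrightarrow> x < 0 \<and> - L / 2 \<le> x \<and> 2 * (- 1 / x) \<le> 3 * L"
      using neg_recip_compare(2)[of x "3 * L"] neg_side[of "3 * L"] L_pos True by (auto simp: J_pos_def)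
    have F: "x \<in> frontier (J_pos q m) \<longleftrightarrow> x \<in> J_pos q m \<and> (x = - L / 2 \<or> x = - 2 / (3 * L))"
      unfolding J_pos_def using True fr by simp
    show ?thesis
    proof (cases "x < 0 \<and> - L / 2 \<le> x")
      case x: True
      then have E: "x = - 2 / (3 * L) \<longleftrightarrow> 2 * (- 1 / x) = 3 * L"
        using neg_recip_compare(3)[of x "3 * L"] L_pos by simp
      have A: "\<bar>- 1 / x - of_int m * L\<bar> \<le> L / 2 \<longleftrightarrow> 2 * (- 1 / x) \<le> 3 * L"
        "\<bar>- 1 / x - of_int m * L\<bar> = L / 2 \<longleftrightarrow> 2 * (- 1 / x) = 3 * L"
        using below[OF conjunct1[OF x] conjunct2[OF x]] unfolding True of_int_1 mult_1 by linarith+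
      show ?thesis unfolding F J A E using x by blast
    qed (use F J in blast)
  next
    case False
    let ?l = "of_int (2 * m - 1) * L" and ?u = "of_int (2 * m + 1) * L"
    have "3 \<le> 2 * m - 1" using False assms by linarith
    then have "(3::real) \<le> of_int (2 * m - 1)" by linarith
    then have l: "3 * L \<le> ?l" using L_pos by (intro mult_right_mono) auto
    have lu: "?l < ?u" using L_pos by simp
    have pos: "0 < ?l" "0 < ?u" using l lu L_pos by linarith+
    have J: "x \<in> J_pos q m \<longleftrightarrow> x < 0 \<and> ?l \<le> 2 * (- 1 / x) \<and> 2 * (- 1 / x) \<le> ?u"
      using neg_recip_compare[of x ?l] neg_recip_compare[of x ?u] neg_side[of ?u] pos False
      unfolding J_pos_def by (auto simp del: of_int_mult of_int_add of_int_diff)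
    have F: "x \<in> frontier (J_pos q m) \<longleftrightarrow> x \<in> J_pos q m \<and> (x = - 2 / ?l \<or> x = - 2 / ?u)"
      unfolding J_pos_def using False fr by simp
    have E: "x = - 2 / ?l \<longleftrightarrow> 2 * (- 1 / x) = ?l" "x = - 2 / ?u \<longleftrightarrow> 2 * (- 1 / x) = ?u" if "x < 0"
      using neg_recip_compare(3) that pos by blast+
    \<comment> \<open>For \<open>m \<ge> 2\<close> the interval stays strictly inside
      \<open>I_q q\<close>, by \<open>2 \<le> L * L\<close>.\<close>
    have inside: "- L / 2 < x" if "x < 0" "?l \<le> 2 * (- 1 / x)"
    proof -
      have "- 2 / (3 * L) \<le> x"
        using that l L_pos by (subst neg_recip_compare) linarith+
      moreover have "2 / (3 * L) < L / 2" using L_sq L_pos by (simp add: field_simps)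
      ultimately show ?thesis by simp
    qed
    have A: "\<bar>t - of_int m * L\<bar> \<le> L / 2 \<longleftrightarrow> ?l \<le> 2 * t \<and> 2 * t \<le> ?u"
      "\<bar>t - of_int m * L\<bar> = L / 2 \<longleftrightarrow> 2 * t = ?l \<or> 2 * t = ?u" for t
    proof -
      define u where "u = t - of_int m * L"
      have "2 * t - ?l = 2 * u + L" "?u - 2 * t = L - 2 * u" by (simp_all add: u_def algebra_simps)
      then have t: "?l \<le> 2 * t \<longleftrightarrow> 0 \<le> 2 * u + L" "2 * t \<le> ?u \<longleftrightarrow> 0 \<le> L - 2 * u"
        "2 * t = ?l \<longleftrightarrow> 2 * u + L = 0" "2 * t = ?u \<longleftrightarrow> L - 2 * u = 0"
        by linarith+
      show "\<bar>t - of_int m * L\<bar> \<le> L / 2 \<longleftrightarrow> ?l \<le> 2 * t \<and> 2 * t \<le> ?u"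
        "\<bar>t - of_int m * L\<bar> = L / 2 \<longleftrightarrow> 2 * t = ?l \<or> 2 * t = ?u"
        unfolding t u_def[symmetric] using L_pos by (auto simp: abs_if)
    qed
    show ?thesis unfolding F J A using E inside by (meson less_imp_le less_irrefl)
  qed
  then show ?iff ?frontier by blast+
qed

text \<open>The description is invariant under changing the signs of \<open>x\<close> and
  \<open>m\<close> together. For \<open>m > 0\<close> the distance condition already forces
  \<open>x < 0\<close>.\<close>

lemma J_int_iff:
  assumes "m \<noteq> 0"
  shows "x \<in> J_int q m \<longleftrightarrow> x \<noteq> 0 \<and> \<bar>x\<bar> \<le> L / 2 \<and> \<bar>- 1 / x - of_int m * L\<bar> \<le> L / 2" (is ?iff)
    and "x \<in> frontier (J_int q m) \<longleftrightarrow>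
      x \<in> J_int q m \<and> (\<bar>x\<bar> = L / 2 \<or> \<bar>- 1 / x - of_int m * L\<bar> = L / 2)" (is ?frontier)
proof -
  have neg: "y < 0" if "0 < n" "y \<noteq> 0" "\<bar>- 1 / y - of_int n * L\<bar> \<le> L / 2" for n :: int and y
  proof -
    have "1 * L \<le> of_int n * L" using that L_pos by (intro mult_right_mono) auto
    then have "0 < - 1 / y" using that(3) L_pos by linarith
    then show ?thesis by (simp add: zero_less_divide_iff)
  qed
  have pos: "(y \<in> J_pos q n \<longleftrightarrow> y \<noteq> 0 \<and> \<bar>y\<bar> \<le> L / 2 \<and> \<bar>- 1 / y - of_int n * L\<bar> \<le> L / 2) \<and>
    (y \<in> frontier (J_pos q n) \<longleftrightarrow>
      y \<in> J_pos q n \<and> (\<bar>y\<bar> = L / 2 \<or> \<bar>- 1 / y - of_int n * L\<bar> = L / 2))" if "0 < n" for n y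
    using J_pos_iff[of n y] neg[of n y] that by (auto simp: abs_le_iff)
  have "?iff \<and> ?frontier"
  proof (cases "m > 0")
    case True
    then show ?thesis using pos[of m x] by (simp add: J_int_def)
  next
    case False
    have "frontier (uminus ` {u..v}) = uminus ` frontier {u..v}" for u v :: real
      unfolding frontier_def image_uminus_atLeastAtMost by (simp add: image_set_diff)
    then have frontier_minus: "frontier (uminus ` J_pos q (- m)) = uminus ` frontier (J_pos q (- m))"
      unfolding J_pos_def by (simp only: split: if_split) blast
    have minus: "x \<in> uminus ` S \<longleftrightarrow> - x \<in> S" for S :: "real set" by force
    have "\<bar>- 1 / - x - of_int (- m) * L\<bar> = \<bar>- 1 / x - of_int m * L\<bar>" by simp
    then show ?thesis
      using pos[of "- m" "- x"] False assms minus by (simp add: J_int_def frontier_minus)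
  qed
  then show ?iff ?frontier by blast+
qed

section \<open>The map \<open>f_q q\<close>, its digits and the regular points\<close>

lemma f_q_nonzero: "x \<noteq> 0 \<Longrightarrow> f_q q x = - 1 / x - of_int (nearest_mult q (- 1 / x)) * L"
  unfolding f_q_def by simp

lemma abs_f_q_le: "\<bar>f_q q x\<bar> \<le> L / 2"
proof (cases "x = 0")
  case True
  then show ?thesis using L_pos by (simp add: f_q_def)
next
  case False
  define y where "y = - 1 / x"
  have "of_int (nearest_mult q y) \<le> y / L + 1 / 2" "y / L + 1 / 2 \<le> of_int (nearest_mult q y) + 1"
    unfolding nearest_mult_def by (rule floor'_bounds)+
  then have "\<bar>y - of_int (nearest_mult q y) * L\<bar> \<le> L / 2"
    using L_pos unfolding abs_le_iff by (simp add: field_simps)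
  then show ?thesis using False by (simp add: f_q_def y_def)
qed

lemma f_q_iterate_mem:
  assumes "x \<in> I_q q"
  shows "\<bar>(f_q q ^^ i) x\<bar> \<le> L / 2"
  using assms abs_f_q_le by (cases i) (auto simp: mem_I_q)

lemma nearest_mult_add:
  assumes "\<bar>y\<bar> < L / 2"
  shows "nearest_mult q (of_int m * L + y) = m"
  unfolding nearest_mult_def
  using assms L_pos by (intro floor'_eqI) (auto simp: field_simps abs_less_iff)

text \<open>Distinct multiples of \<open>L\<close> are at least \<open>L\<close> apart, but the two
  distances add up to less than \<open>L\<close>.\<close>

lemma digit_dist:
  fixes b n :: int
  assumes "\<bar>y\<bar> < L / 2" "\<bar>of_int n * L + y - of_int b * L\<bar> \<le> L / 2"
  shows "b = n"
proof (rule ccontr)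
  assume "b \<noteq> n"
  then have "1 \<le> \<bar>real_of_int (n - b)\<bar>" by linarith
  then have "1 * L \<le> \<bar>real_of_int (n - b)\<bar> * L" using L_pos by (intro mult_right_mono) auto
  then have "L \<le> \<bar>real_of_int (n - b) * L\<bar>" using L_pos by (simp add: abs_mult)
  moreover have "of_int n * L + y - of_int b * L = real_of_int (n - b) * L + y" by (simp add: algebra_simps)
  ultimately show False using assms by linarith
qed

lemma nearest_mult_nonzero:
  assumes "x \<noteq> 0" "\<bar>x\<bar> \<le> L / 2"
  shows "nearest_mult q (- 1 / x) \<noteq> 0"
proof
  assume "nearest_mult q (- 1 / x) = 0"
  then have "\<bar>1 / x\<bar> \<le> L / 2" using f_q_nonzero[OF assms(1)] abs_f_q_le[of x] by simp
  moreover have "2 / L \<le> \<bar>1 / x\<bar>" using assms L_pos by (simp add: field_simps)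
  ultimately show False using L_half by linarith
qed

text \<open>The strict bound keeps \<open>x\<close> off the common ends of neighbouring intervals,
  so closed intervals and rounding single out the same digit.\<close>

lemma mem_J_int_iff_digit:
  assumes "x \<noteq> 0" "\<bar>x\<bar> \<le> L / 2" "\<bar>f_q q x\<bar> < L / 2"
  shows "b \<noteq> 0 \<and> x \<in> J_int q b \<longleftrightarrow> b = nearest_mult q (- 1 / x)"
proof
  assume "b \<noteq> 0 \<and> x \<in> J_int q b"
  then have "\<bar>- 1 / x - of_int b * L\<bar> \<le> L / 2" using J_int_iff(1) by blast
  then have "\<bar>of_int (nearest_mult q (- 1 / x)) * L + f_q q x - of_int b * L\<bar> \<le> L / 2"
    unfolding f_q_nonzero[OF assms(1)] by simp
  then show "b = nearest_mult q (- 1 / x)" by (rule digit_dist[OF assms(3)])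
next
  assume b: "b = nearest_mult q (- 1 / x)"
  have "b \<noteq> 0" unfolding b by (rule nearest_mult_nonzero[OF assms(1,2)])
  moreover have "- 1 / x - of_int b * L = f_q q x" unfolding b f_q_nonzero[OF assms(1)] ..
  ultimately show "b \<noteq> 0 \<and> x \<in> J_int q b" using J_int_iff(1)[of b x] assms by simp
qed

text \<open>A nonzero point always lies in the interval of its rounded digit, on the frontier
  exactly if \<open>x\<close> or \<open>f_q q x\<close> is an endpoint of \<open>I_q q\<close>;
  uniqueness of the digit excludes other frontiers.\<close>

lemma not_special_iff:
  assumes "\<bar>x\<bar> \<le> L / 2"
  shows "x \<notin> insert 0 (\<Union>m \<in> UNIV - {0}. frontier (J_int q m)) \<longleftrightarrow>
    x \<noteq> 0 \<and> \<bar>x\<bar> < L / 2 \<and> \<bar>f_q q x\<bar> < L / 2"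
proof (cases "x = 0")
  case False
  let ?n = "nearest_mult q (- 1 / x)"
  have n: "?n \<noteq> 0" by (rule nearest_mult_nonzero[OF False assms])
  have "\<bar>- 1 / x - of_int ?n * L\<bar> = \<bar>f_q q x\<bar>" unfolding f_q_nonzero[OF False] ..
  then have J: "x \<in> J_int q ?n" and F: "x \<in> frontier (J_int q ?n) \<longleftrightarrow> \<bar>x\<bar> = L / 2 \<or> \<bar>f_q q x\<bar> = L / 2"
    unfolding J_int_iff[OF n] using False assms abs_f_q_le[of x] by auto
  have "\<bar>x\<bar> = L / 2 \<or> \<bar>f_q q x\<bar> = L / 2" if m: "m \<noteq> 0" and x: "x \<in> frontier (J_int q m)" for m
  proof (rule ccontr)
    assume neg: "\<not> ?thesis"
    then have "\<bar>f_q q x\<bar> < L / 2" using abs_f_q_le[of x] by linarith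
    moreover have "x \<in> J_int q m" using x J_int_iff(2)[OF m] by blast
    ultimately have "m = ?n" using mem_J_int_iff_digit[OF False assms] m by blast
    then show False using x F neg by simp
  qed
  then have "(\<exists>m. m \<noteq> 0 \<and> x \<in> frontier (J_int q m)) \<longleftrightarrow> \<bar>x\<bar> = L / 2 \<or> \<bar>f_q q x\<bar> = L / 2"
    using F n by blast
  moreover have "x \<notin> insert 0 (\<Union>m \<in> UNIV - {0}. frontier (J_int q m)) \<longleftrightarrow>
    \<not> (\<exists>m. m \<noteq> 0 \<and> x \<in> frontier (J_int q m))"
    using False by blast
  moreover have "\<bar>x\<bar> < L / 2 \<longleftrightarrow> \<bar>x\<bar> \<noteq> L / 2" "\<bar>f_q q x\<bar> < L / 2 \<longleftrightarrow> \<bar>f_q q x\<bar> \<noteq> L / 2"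
    using assms abs_f_q_le[of x] by (simp_all only: less_le simp_thms)
  ultimately show ?thesis using False by (simp only: simp_thms de_Morgan_disj)
qed simp

text \<open>The condition on \<open>f_q q x\<close> is the endpoint condition at the next iterate,
  so it is absorbed by the quantifier over \<open>n\<close>.\<close>

lemma mem_regular_points_iff:
  "x \<in> I_q q - boundary_J q \<longleftrightarrow>
    \<bar>x\<bar> \<le> L / 2 \<and> (\<forall>n. (f_q q ^^ n) x \<noteq> 0 \<and> \<bar>(f_q q ^^ n) x\<bar> < L / 2)"
proof (cases "x \<in> I_q q")
  case True
  have "x \<in> I_q q - boundary_J q \<longleftrightarrow>
    (\<forall>n. (f_q q ^^ n) x \<notin> insert 0 (\<Union>m \<in> UNIV - {0}. frontier (J_int q m)))"
    unfolding boundary_J_def using True by blast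
  also have "\<dots> \<longleftrightarrow> (\<forall>n. (f_q q ^^ n) x \<noteq> 0 \<and> \<bar>(f_q q ^^ n) x\<bar> < L / 2 \<and> \<bar>(f_q q ^^ Suc n) x\<bar> < L / 2)"
    by (simp only: not_special_iff[OF f_q_iterate_mem[OF True]] funpow.simps o_apply)
  also have "\<dots> \<longleftrightarrow> (\<forall>n. (f_q q ^^ n) x \<noteq> 0 \<and> \<bar>(f_q q ^^ n) x\<bar> < L / 2)" by blast
  finally show ?thesis using True by (simp add: mem_I_q)
qed (simp add: mem_I_q)

lemma regular_point_digits:
  assumes "x \<in> I_q q - boundary_J q"
  shows "b \<noteq> 0 \<and> (f_q q ^^ i) x \<in> J_int q b \<longleftrightarrow> b = nearest_mult q (- 1 / (f_q q ^^ i) x)"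
proof -
  have x: "(f_q q ^^ n) x \<noteq> 0 \<and> \<bar>(f_q q ^^ n) x\<bar> < L / 2" for n
    using assms unfolding mem_regular_points_iff by blast
  show ?thesis using x[of i] x[of "Suc i"] by (intro mem_J_int_iff_digit) auto
qed

lemma pi_hat_eq:
  assumes "x \<in> I_q q - boundary_J q"
  shows "pi_hat q x i = nearest_mult q (- 1 / (f_q q ^^ i) x)"
  unfolding pi_hat_def regular_point_digits[OF assms] by simp

lemma regular_point_branch:
  assumes "x \<in> I_q q - boundary_J q"
  shows "(f_q q ^^ i) x = - 1 / (of_int (pi_hat q x i) * L + (f_q q ^^ Suc i) x)"
    and "pi_hat q x i \<noteq> 0"
proof -
  let ?y = "(f_q q ^^ i) x"
  have "?y \<noteq> 0" using assms unfolding mem_regular_points_iff by blast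
  then have "- 1 / ?y = of_int (pi_hat q x i) * L + (f_q q ^^ Suc i) x"
    by (simp add: f_q_nonzero pi_hat_eq[OF assms])
  then show "?y = - 1 / (of_int (pi_hat q x i) * L + (f_q q ^^ Suc i) x)"
    by (metis divide_divide_eq_right minus_divide_left minus_minus mult_1 div_by_1 minus_divide_right)
  show "pi_hat q x i \<noteq> 0"
    using regular_point_digits[OF assms] unfolding pi_hat_eq[OF assms] by blast
qed

text \<open>\<open>\<phi>\<close> at index \<open>h\<close> is at least the right endpoint of \<open>J\<^sub>1\<close>, so \<open>h\<close> digits \<open>1\<close> of an orbit
  cannot be followed by another one.\<close>

lemma phi_h_ge:
  assumes "odd q"
  shows "- 1 / (L + L / 2) \<le> \<phi> h"
proof -
  have "\<phi> h = - 1 / (L + 1)" using cf_two_ones[OF assms] assms by (simp add: endpoint_word_def)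
  moreover have "- 1 / (L + L / 2) \<le> - 1 / (L + 1)" using L_less L_pos by (simp add: field_simps)
  ultimately show ?thesis by simp
qed

section \<open>Regularity of orbit digits, injectivity and surjectivity\<close>

lemma pi_hat_in_A_reg:
  assumes "x \<in> I_q q - boundary_J q"
  shows "pi_hat q x \<in> A_reg q"
proof -
  define a where "a = pi_hat q x"
  define X where "X = (\<lambda>i. (f_q q ^^ i) x)"
  have X: "X i = - 1 / (of_int (a i) * L + X (Suc i))" and a: "a i \<noteq> 0" for i
    using regular_point_branch[OF assms] unfolding a_def X_def by blast+
  have b: "\<bar>X i\<bar> < L / 2" for i
    using assms unfolding mem_regular_points_iff X_def by blast
  have blocks: "\<not> (\<forall>i\<le>h. a (k + i) = s) \<and> ((\<forall>i<N. a (k + i) = s * d ! i) \<longrightarrow> s * a (k + N) < 1)"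
    if s: "s \<in> {1, -1}" for k and s :: int
  proof -
    let ?sX = "\<lambda>i. of_int s * X (k + i)"
    have sX: "?sX i = - 1 / (of_int (s * a (k + i)) * L + ?sX (Suc i))" for i
      using X[of "k + i"] sign_branch[OF s] by (metis add_Suc_right)
    have sb: "\<bar>?sX i\<bar> < L / 2" for i using b[of "k + i"] s by auto
    have sa: "s * a i \<noteq> 0" for i using a s by auto
    \<comment> \<open>The orbit never meets an endpoint, so the comparison starts strictly at
      \<open>\<phi> 0 = - L / 2\<close> and stays strict.\<close>
    have follow: "\<phi> j < ?sX j" if "j \<le> N" "\<forall>i<j. a (k + i) = s * d ! i" for j
      using that
    proof (induction j)
      case 0
      then show ?case using sb[of 0] unfolding phi_0 by linarith
    next
      case (Suc j)
      then have j: "j < N" and IH: "\<phi> j < ?sX j" by auto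
      have "s * a (k + j) = d ! j" using Suc.prems s by auto
      then show ?case using phi_branch_iff(2)[OF j less_imp_le[OF sb[of "Suc j"]]] IH sX[of j] by simp
    qed
    \<comment> \<open>At the end of \<open>d\<close> the strict bound is
      \<open>\<phi> N = 0\<close>, but a digit of sign \<open>s\<close> would make
      \<open>?sX N\<close> negative.\<close>
    have neg: "s * a (k + N) < 1" if "\<forall>i<N. a (k + i) = s * d ! i"
    proof (rule ccontr)
      assume "\<not> ?thesis"
      then have "of_int (s * a (k + N)) * L + ?sX (Suc N) > 0"
        using branch_denominator(2)[OF sa less_imp_le[OF sb[of "Suc N"]], of "k + N"] by linarith
      then have "?sX N < 0" by (subst sX) simp
      then show False using follow[OF order_refl that] by simp
    qed
    moreover have "\<not> (\<forall>i\<le>h. a (k + i) = s)"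
    proof
      assume ones: "\<forall>i\<le>h. a (k + i) = s"
      then have pre: "\<forall>i<h. a (k + i) = s * d ! i" by (simp add: endpoint_word_nth_ones)
      have sah: "s * a (k + h) = 1" using ones s by auto
      show False
      proof (cases "even q")
        case True
        \<comment> \<open>For even \<open>q\<close> the word \<open>d\<close> is the run of
          \<open>h\<close> ones, so one more 1 contradicts \<open>neg\<close>.\<close>
        then show False using neg pre sah by (simp add: endpoint_word_def)
      next
        case False
        have "?sX h = - 1 / (L + ?sX (Suc h))" using sX[of h] sah by simp
        also have "\<dots> \<le> - 1 / (L + L / 2)"
          using sb[of "Suc h"] L_pos by (auto simp: divide_simps abs_less_iff)
        finally show False using phi_h_ge[OF False] follow[OF h_le_N pre] by linarith
      qed
    qed
    ultimately show ?thesis by blast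
  qed
  show ?thesis unfolding A_reg_iff a_def[symmetric]
    by (rule conjI, intro allI, rule a, intro allI impI, rule blocks)
qed

text \<open>Orbits with equal digits pass through the same branches for every \<open>n\<close>, so
  the contraction forces their starting points to coincide.\<close>

lemma inj_on_pi_hat: "inj_on (pi_hat q) (I_q q - boundary_J q)"
proof (rule inj_onI)
  fix x y
  assume x: "x \<in> I_q q - boundary_J q" and y: "y \<in> I_q q - boundary_J q" and eq: "pi_hat q x = pi_hat q y"
  have b: "\<bar>(f_q q ^^ i) x\<bar> \<le> L / 2" "\<bar>(f_q q ^^ i) y\<bar> \<le> L / 2" for i
    using x y f_q_iterate_mem by blast+
  have "\<bar>x - y\<bar> \<le> (L\<^sup>2 / 4) ^ n * L" for n
  proof -
    have "\<bar>(f_q q ^^ 0) x - (f_q q ^^ 0) y\<bar> \<le> (L\<^sup>2 / 4) ^ n * \<bar>(f_q q ^^ n) x - (f_q q ^^ n) y\<bar>"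
    proof (rule branch_contraction[where a = "pi_hat q x"])
      show "(f_q q ^^ i) y = - 1 / (of_int (pi_hat q x i) * L + (f_q q ^^ Suc i) y)" for i
        unfolding eq by (rule regular_point_branch[OF y])
    qed (rule regular_point_branch[OF x] b)+
    also have "\<dots> \<le> (L\<^sup>2 / 4) ^ n * L" using b[of n] by (intro mult_left_mono) auto
    finally show ?thesis by simp
  qed
  then have "\<bar>x - y\<bar> \<le> 0"
    by (intro LIMSEQ_le_const[OF contraction_tendsto]) blast
  then show "x = y" by simp
qed

text \<open>The limit tails are nonzero and strictly inside \<open>I_q q\<close>, so rounding
  \<open>- 1 / X k\<close> recovers \<open>a k\<close>, and \<open>f_q q\<close> moves each tail to
  the next one.\<close>

lemma A_reg_expansion:
  assumes a: "a \<in> A_reg q"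
  obtains x where "x \<in> I_q q - boundary_J q" "pi_hat q x = a"
    "(\<lambda>n. lambda_cf q (map a [0..<n])) \<longlonglongrightarrow> x"
proof -
  obtain X where lim: "(\<lambda>n. lambda_cf q (map a [0..<n])) \<longlonglongrightarrow> X 0"
    and X: "\<And>k. X k = - 1 / (of_int (a k) * L + X (Suc k))" and b: "\<And>k. \<bar>X k\<bar> \<le> L / 2"
    by (rule cf_limits[OF a], rule that)
  have sb: "\<bar>X k\<bar> < L / 2" for k using tail_not_endpoint[OF a X b] .
  have den: "of_int (a k) * L + X (Suc k) \<noteq> 0" for k
    by (rule branch_denominator[OF A_reg_nonzero[OF a] b])
  have nz: "X k \<noteq> 0" for k using den[of k] by (subst X) simp
  have inv: "- 1 / X k = of_int (a k) * L + X (Suc k)" for k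
    using den[of k] by (subst X) simp
  have nm: "nearest_mult q (- 1 / X k) = a k" for k
    unfolding inv by (rule nearest_mult_add[OF sb])
  have f: "f_q q (X k) = X (Suc k)" for k
    unfolding f_q_nonzero[OF nz] nm unfolding inv by simp
  have iter: "(f_q q ^^ k) (X 0) = X k" for k by (induction k) (simp_all add: f)
  have mem: "X 0 \<in> I_q q - boundary_J q"
    unfolding mem_regular_points_iff iter by (intro conjI allI b sb nz)
  moreover have "pi_hat q (X 0) = a"
    unfolding fun_eq_iff pi_hat_eq[OF mem] iter nm by simp
  ultimately show ?thesis using that lim by blast
qed

end

theorem lemma4p2p2:
  fixes q :: nat
  assumes "q \<ge> 4"
  shows "(\<forall>x \<in> I_q q - boundary_J q. \<forall>i. \<exists>!a. a \<noteq> 0 \<and> (f_q q ^^ i) x \<in> J_int q a)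
    \<and> bij_betw (pi_hat q) (I_q q - boundary_J q) (A_reg q)
    \<and> (\<forall>a \<in> A_reg q.
         (\<lambda>n. lambda_cf q (map a [0..<n])) \<longlonglongrightarrow> the_inv_into (I_q q - boundary_J q) (pi_hat q) a)"
proof -
  interpret hecke q by unfold_locales (rule assms)
  show ?thesis
  proof (intro conjI ballI allI)
    \<comment> \<open>Existence and uniqueness of the digit give the \<open>THE\<close> in
      \<open>pi_hat\<close> its intended value.\<close>
    fix x i
    assume "x \<in> I_q q - boundary_J q"
    then show "\<exists>!a. a \<noteq> 0 \<and> (f_q q ^^ i) x \<in> J_int q a"
      by (simp add: regular_point_digits)
  next
    have "pi_hat q ` (I_q q - boundary_J q) = A_reg q"
    proof
      show "pi_hat q ` (I_q q - boundary_J q) \<subseteq> A_reg q" using pi_hat_in_A_reg by blast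
      show "A_reg q \<subseteq> pi_hat q ` (I_q q - boundary_J q)"
      proof
        fix a assume "a \<in> A_reg q"
        from A_reg_expansion[OF this] show "a \<in> pi_hat q ` (I_q q - boundary_J q)" by blast
      qed
    qed
    then show "bij_betw (pi_hat q) (I_q q - boundary_J q) (A_reg q)"
      using inj_on_pi_hat unfolding bij_betw_def by blast
  next
    fix a assume "a \<in> A_reg q"
    then obtain x where "x \<in> I_q q - boundary_J q" "pi_hat q x = a"
      and lim: "(\<lambda>n. lambda_cf q (map a [0..<n])) \<longlonglongrightarrow> x"
      by (rule A_reg_expansion)
    then have "the_inv_into (I_q q - boundary_J q) (pi_hat q) a = x"
      using the_inv_into_f_eq[OF inj_on_pi_hat] by blast
    then show "(\<lambda>n. lambda_cf q (map a [0..<n])) \<longlonglongrightarrow> the_inv_into (I_q q - boundary_J q) (pi_hat q) a"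
      using lim by simp
  qed
qed

end
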